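(* There is an integer $n_0$ such that for all integers $n\ge n_0$ and all positive integers $s\le 2^{\lfloor n/8\rfloor}/n$, any even-sized family $\mathcal A\subset 2^{[n]}$ with $|\mathcal A|\ge 2^{\lfloor n/2\rfloor}+s$ satisfies $op(\mathcal A)\ge s\cdot 2^{\lfloor n/2\rfloor-1}$.
   Context: $[n]=\{1,2,\ldots,n\}$ and $2^{[n]}$ is the collection of all subsets of $[n]$. A family $\mathcal A\subset 2^{[n]}$ is a set of (distinct) subsets of $[n]$; it is even-sized if every member has even cardinality. The odd pair number $op(\mathcal A)$ is the number of (unordered) pairs of distinct members $A,B\in\mathcal A$ such that $|A\cap B|$ is odd. *)

theory Defs
  imports Complex_Main
begin

definition even_sized :: "'a set set \<Rightarrow> bool" where
  "even_sized \<A> \<longleftrightarrow> (\<forall>A\<in>\<A>. even (card A))"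

(* Unordered pairs of distinct members are represented as two-element sets {A, B},
   so each pair is counted once. *)
definition odd_pairs :: "'a set set \<Rightarrow> 'a set set set" where
  "odd_pairs \<A> = {{A, B} | A B. A \<in> \<A> \<and> B \<in> \<A> \<and> A \<noteq> B \<and> odd (card (A \<inter> B))}"

definition odd_pair_number :: "'a set set \<Rightarrow> nat" where
  "odd_pair_number \<A> = card (odd_pairs \<A>)"

end

theory Submission
  imports Defs "HOL-Computational_Algebra.Primes"
begin

text \<open>
  Regard the subsets of an \<open>n\<close>-element set \<open>V\<close> as the vectors of the \<open>n\<close>-dimensional space over
  the field with two elements: addition is symmetric difference and \<open>card (x \<inter> y)\<close> modulo 2 is the
  standard bilinear form. An odd pair is a pair of non-orthogonal vectors, and an isotropic family
  is one in which every two members, equal or not, are orthogonal. Such a family has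
  at most \<open>N = 2 ^ (n div 2)\<close> members.

  Let \<open>\<A>\<close> be even-sized with \<open>N + s\<close> members and suppose that it has fewer than \<open>s N / 2\<close> odd pairs.
  Call the number of members of \<open>\<A>\<close> not orthogonal to a given one its degree. The degrees sum to
  less than \<open>s N\<close>, so fewer than \<open>N / 3\<close> members have degree above \<open>3 s\<close>. Let \<open>B\<close> consist of the
  other members. Being orthogonal to \<open>B\<close> is the same as being orthogonal to at most \<open>n\<close> elements that
  span \<open>B\<close>, and each of these excludes at most \<open>3 s\<close> members of \<open>\<A>\<close>. So all but \<open>3 s n\<close> members
  of \<open>\<A>\<close> lie in the orthogonal space of \<open>B\<close>, and those of them that are in \<open>B\<close> lie in the radical
  \<open>K\<close> of the span of \<open>B\<close>, an isotropic subspace (lemma \<open>mostly_isotropic\<close>).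

  When \<open>s n\<close> is small compared with \<open>N\<close>, fewer than \<open>N / 2\<close> members of \<open>\<A>\<close> are outside \<open>K\<close>,
  so \<open>K\<close> contains more than \<open>N / 2\<close> sets. Its cardinality is a power of two that is at most \<open>N\<close>,
  hence equals \<open>N\<close>. Now \<open>K\<close> cannot be enlarged, so a member of \<open>\<A>\<close> outside \<open>K\<close> is
  non-orthogonal to some, hence to exactly half, of the elements of \<open>K\<close>. If \<open>\<A>\<close> misses \<open>d\<close> elements
  of \<open>K\<close>, it has \<open>d + s\<close> members outside, and these lie in at least \<open>(d + s) (N / 2 - d)\<close> odd pairs
  (lemma \<open>odd_pairs_outside_maximal\<close>). This is at least \<open>s N / 2\<close> as long as \<open>d + s \<le> N / 2\<close>,
  a contradiction.
\<close>

section \<open>Orthogonality over the field with two elements\<close>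

text \<open>Additivity of the bilinear form: the common part of \<open>x\<close> and \<open>y\<close> is counted twice on the right.\<close>

lemma even_card_sym_diff_Int:
  assumes "finite z"
  shows "even (card (sym_diff x y \<inter> z)) \<longleftrightarrow> (even (card (x \<inter> z)) \<longleftrightarrow> even (card (y \<inter> z)))"
proof -
  let ?x = "x \<inter> z" and ?y = "y \<inter> z"
  have fin: "finite ?x" "finite ?y" using assms by auto
  have eq: "sym_diff x y \<inter> z = (?x - ?y) \<union> (?y - ?x)" by blast
  have "card (sym_diff x y \<inter> z) = card (?x - ?y) + card (?y - ?x)"
    unfolding eq using fin by (intro card_Un_disjoint) auto
  moreover have "card ?x = card (?x - ?y) + card (?x \<inter> ?y)"
    using fin by (metis card_Diff_subset_Int card_mono finite_Int inf_le1 le_add_diff_inverse2)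
  moreover have "card ?y = card (?y - ?x) + card (?x \<inter> ?y)"
    using fin by (metis card_Diff_subset_Int card_mono finite_Int inf_commute inf_le1 le_add_diff_inverse2)
  ultimately show ?thesis by (metis even_add)
qed

definition subspace_in :: "'a set \<Rightarrow> 'a set set \<Rightarrow> bool" where
  "subspace_in V U \<longleftrightarrow> U \<subseteq> Pow V \<and> {} \<in> U \<and> (\<forall>x\<in>U. \<forall>y\<in>U. sym_diff x y \<in> U)"

definition orth :: "'a set \<Rightarrow> 'a set set \<Rightarrow> 'a set set" where
  "orth V F = {y \<in> Pow V. \<forall>x\<in>F. even (card (x \<inter> y))}"

definition isotropic :: "'a set set \<Rightarrow> bool" where
  "isotropic F \<longleftrightarrow> (\<forall>x\<in>F. \<forall>y\<in>F. even (card (x \<inter> y)))"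

lemma subspace_in_Pow: "subspace_in V (Pow V)"
  unfolding subspace_in_def by blast

lemma subspace_in_Int: "subspace_in V U \<Longrightarrow> subspace_in V W \<Longrightarrow> subspace_in V (U \<inter> W)"
  unfolding subspace_in_def by blast

lemma subspace_in_finite: "finite V \<Longrightarrow> subspace_in V U \<Longrightarrow> finite U"
  unfolding subspace_in_def by (meson finite_Pow_iff finite_subset)

lemma subspace_in_orth:
  assumes "finite V" "F \<subseteq> Pow V"
  shows "subspace_in V (orth V F)"
proof -
  have "sym_diff x y \<in> orth V F" if "x \<in> orth V F" "y \<in> orth V F" for x y
  proof -
    have "even (card (f \<inter> sym_diff x y))" if "f \<in> F" for f
    proof -
      have "finite f" using assms that by (meson PowD finite_subset subsetD)
      then show ?thesis
        using even_card_sym_diff_Int[of f x y] that \<open>x \<in> orth V F\<close> \<open>y \<in> orth V F\<close>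
        by (simp add: orth_def Int_commute)
    qed
    then show ?thesis using that by (auto simp: orth_def)
  qed
  then show ?thesis unfolding subspace_in_def by (auto simp: orth_def)
qed

text \<open>
  A linear functional on \<open>W\<close> that does not vanish takes both values equally often: adding a vector
  \<open>w\<close> with value 1 exchanges the two fibres.
\<close>

lemma card_odd_Int_half:
  assumes "finite V" "subspace_in V W" "finite z" "w \<in> W" "odd (card (w \<inter> z))"
  shows "2 * card {x \<in> W. odd (card (x \<inter> z))} = card W"
    and "2 * card {x \<in> W. even (card (x \<inter> z))} = card W"
proof -
  let ?O = "{x \<in> W. odd (card (x \<inter> z))}" and ?E = "{x \<in> W. even (card (x \<inter> z))}"
  have finW: "finite W" using assms subspace_in_finite by blast
  have cl: "sym_diff w x \<in> W" if "x \<in> W" for x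
    using assms that unfolding subspace_in_def by blast
  have inv: "sym_diff w (sym_diff w x) = x" for x by blast
  have flip: "even (card (sym_diff w x \<inter> z)) \<longleftrightarrow> odd (card (x \<inter> z))" for x
    using even_card_sym_diff_Int[OF assms(3), of w x] assms(5) by blast
  have "bij_betw (sym_diff w) ?O ?E"
    by (rule bij_betw_byWitness[where f' = "sym_diff w"]) (use cl inv flip in auto)
  then have eq: "card ?O = card ?E" by (rule bij_betw_same_card)
  have "card W = card (?O \<union> ?E)" by (rule arg_cong[where f = card]) blast
  also have "\<dots> = card ?O + card ?E" using finW by (intro card_Un_disjoint) auto
  finally show "2 * card ?O = card W" "2 * card ?E = card W" using eq by simp_all
qed

text \<open>
  Count the orthogonal pairs in \<open>U \<times> Pow V\<close> in two ways. A row or column contributes all of its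
  entries if its functional vanishes, and half of them otherwise. The functional of
  \<open>x \<in> U\<close> vanishes on \<open>Pow V\<close> only for \<open>x = {}\<close>; that of \<open>y \<in> Pow V\<close> vanishes on \<open>U\<close> exactly
  for \<open>y \<in> orth V U\<close>. So twice the number of pairs equals both
  \<open>card U * 2 ^ card V + 2 ^ card V\<close> and \<open>2 ^ card V * card U + card U * card (orth V U)\<close>.
\<close>

lemma card_mult_card_orth:
  assumes "finite V" "subspace_in V U"
  shows "card U * card (orth V U) = 2 ^ card V"
proof -
  let ?e = "\<lambda>x y. of_bool (even (card (x \<inter> y))) :: nat"
  have finU: "finite U" and UV: "U \<subseteq> Pow V" "{} \<in> U"
    using assms subspace_in_finite by (auto simp: subspace_in_def)
  have orthV: "orth V U \<subseteq> Pow V" by (auto simp: orth_def)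
  have finP: "finite (Pow V)" using assms by simp
  have count: "(\<Sum>x\<in>S. ?e x z) = card {x \<in> S. even (card (x \<inter> z))}" if "finite S" for S z
    using that by (simp add: sum.If_cases of_bool_def Int_def)
  have row: "2 * (\<Sum>y\<in>Pow V. ?e x y) = 2 ^ card V + (if x = {} then 2 ^ card V else 0)"
    if "x \<in> U" for x
  proof (cases "x = {}")
    case True then show ?thesis using assms by (simp add: card_Pow)
  next
    case False
    then obtain a where a: "a \<in> x" by blast
    have "x \<subseteq> V" using that UV by blast
    then have "{a} \<in> Pow V" "finite x" using a assms finite_subset by auto
    moreover have "odd (card ({a} \<inter> x))" using a by simp
    ultimately show ?thesis
      using card_odd_Int_half(2)[OF assms(1) subspace_in_Pow, of x "{a}"] count[OF finP, of x] False
      by (simp add: card_Pow assms Int_commute)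
  qed
  have col: "2 * (\<Sum>x\<in>U. ?e x y) = card U + (if y \<in> orth V U then card U else 0)"
    if "y \<in> Pow V" for y
  proof (cases "y \<in> orth V U")
    case True then show ?thesis by (simp add: orth_def)
  next
    case False
    then obtain x where "x \<in> U" "odd (card (x \<inter> y))" using \<open>y \<in> Pow V\<close> unfolding orth_def by blast
    moreover have "finite y" using that assms finite_subset by auto
    ultimately show ?thesis
      using card_odd_Int_half(2)[OF assms, of y x] count[OF finU, of y] False by simp
  qed
  have "card U * 2 ^ card V + 2 ^ card V = (\<Sum>x\<in>U. 2 * (\<Sum>y\<in>Pow V. ?e x y))"
    using row finU UV by (simp add: sum.distrib sum.delta)
  also have "\<dots> = (\<Sum>y\<in>Pow V. 2 * (\<Sum>x\<in>U. ?e x y))"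
    unfolding sum_distrib_left by (rule sum.swap)
  also have "\<dots> = (\<Sum>y\<in>Pow V. card U + (if y \<in> orth V U then card U else 0))"
    by (rule sum.cong) (use col in auto)
  also have "\<dots> = 2 ^ card V * card U + card (orth V U) * card U"
    using finP orthV by (simp add: sum.distrib card_Pow assms sum.If_cases Int_absorb1 Int_absorb2)
  finally show ?thesis by (simp add: mult.commute)
qed

text \<open>
  This replaces the choice of a basis of the span of \<open>F\<close>. Running through \<open>F\<close>, keep only those
  elements that shrink the orthogonal space; each of them halves it, which can happen at most
  \<open>card V\<close> times.
\<close>

lemma orth_generated_by_few:
  assumes "finite V" "F \<subseteq> Pow V"
  shows "\<exists>X\<subseteq>F. orth V X = orth V F \<and> card X \<le> card V"
proof -
  have "finite F" using assms finite_subset by auto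
  \<comment> \<open>The bound on \<open>card X\<close> is strengthened to an equation that records the halvings.\<close>
  then have "F \<subseteq> Pow V \<Longrightarrow> \<exists>X\<subseteq>F. orth V X = orth V F \<and> card (orth V X) * 2 ^ card X = 2 ^ card V"
  proof (induction F)
    case empty
    have "orth V {} = Pow V" by (auto simp: orth_def)
    then show ?case using assms by (simp add: card_Pow)
  next
    case (insert b F)
    then obtain X where X: "X \<subseteq> F" "orth V X = orth V F"
      "card (orth V X) * 2 ^ card X = 2 ^ card V" by auto
    have ins: "orth V (insert b G) = {y \<in> orth V G. even (card (y \<inter> b))}" for G
      by (auto simp: orth_def Int_commute)
    show ?case
    proof (cases "\<forall>y\<in>orth V F. even (card (y \<inter> b))")
      case True
      then have "orth V (insert b F) = orth V F" unfolding ins by blast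
      then show ?thesis using X by blast
    next
      case False
      then obtain y where y: "y \<in> orth V X" "odd (card (y \<inter> b))" using X by auto
      have "finite b" using insert.prems assms finite_subset by auto
      moreover have "subspace_in V (orth V X)"
        using X insert.prems assms by (intro subspace_in_orth) auto
      ultimately have "2 * card (orth V (insert b X)) = card (orth V X)"
        unfolding ins using card_odd_Int_half(2)[OF assms(1) _ _ y] by blast
      moreover have "card (insert b X) = Suc (card X)"
        using X insert.hyps by (meson card_insert_disjoint finite_subset subsetD)
      ultimately have "card (orth V (insert b X)) * 2 ^ card (insert b X) = 2 ^ card V"
        using X(3) by (metis mult.assoc mult.commute power_Suc)
      moreover have "orth V (insert b X) = orth V (insert b F)" unfolding ins X(2) ..
      ultimately show ?thesis using X(1) by (intro exI[of _ "insert b X"]) auto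
    qed
  qed
  then obtain X where X: "X \<subseteq> F" "orth V X = orth V F" "card (orth V X) * 2 ^ card X = 2 ^ card V"
    using assms by blast
  have "(2::nat) ^ card X dvd 2 ^ card V" using X(3) by (metis dvd_triv_right)
  then have "card X \<le> card V" by (simp add: power_dvd_imp_le)
  then show ?thesis using X by blast
qed

section \<open>Isotropic families\<close>

text \<open>
  The double orthogonal space plays the part of the span of \<open>F\<close>, so \<open>K\<close> is the radical of that span.
\<close>

lemma isotropic_hull:
  assumes "finite V" "F \<subseteq> Pow V"
  defines "K \<equiv> orth V F \<inter> orth V (orth V F)"
  shows "subspace_in V K" "isotropic K" "F \<inter> orth V F \<subseteq> K"
proof -
  have "subspace_in V (orth V F)" using assms subspace_in_orth by blast
  moreover have "subspace_in V (orth V (orth V F))"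
    using assms by (intro subspace_in_orth) (auto simp: orth_def)
  ultimately show "subspace_in V K" unfolding K_def by (rule subspace_in_Int)
  show "isotropic K" unfolding isotropic_def K_def orth_def by blast
  show "F \<inter> orth V F \<subseteq> K" unfolding K_def orth_def by (auto simp: Int_commute)
qed

text \<open>
  An isotropic \<open>K\<close> is contained in \<open>orth V K\<close>, so the square of its cardinality is at most
  \<open>2 ^ card V\<close>. Knowing that the cardinality is a power of two does more than round
  the exponent down for odd \<open>card V\<close>: an isotropic subspace with more than half of the maximal number of
  elements must attain the maximum.
\<close>

lemma card_isotropic_subspace:
  assumes "finite V" "subspace_in V K" "isotropic K"
  shows "\<exists>k \<le> card V div 2. card K = 2 ^ k"
proof -
  have prod: "card K * card (orth V K) = 2 ^ card V" using assms card_mult_card_orth by blast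
  then have "card K dvd 2 ^ card V" by (metis dvd_triv_left)
  then obtain k where k: "card K = 2 ^ k" using divides_primepow_nat[OF two_is_prime_nat] by blast
  have "K \<subseteq> orth V K" using assms(2,3) by (auto simp: subspace_in_def orth_def isotropic_def)
  moreover have "finite (orth V K)" using assms(1) by (auto simp: orth_def)
  ultimately have "card K * card K \<le> 2 ^ card V" using prod card_mono by (metis mult_le_mono2)
  then have "(2::nat) ^ (k + k) \<le> 2 ^ card V" by (simp add: k power_add)
  then have "k + k \<le> card V" by simp
  then show ?thesis using k by (intro exI[of _ k]) auto
qed

text \<open>The eventown theorem: an isotropic family lies in its own radical, an isotropic subspace.\<close>

lemma eventown_bound:
  assumes "finite V" "F \<subseteq> Pow V" "isotropic F"
  shows "card F \<le> 2 ^ (card V div 2)"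
proof -
  let ?K = "orth V F \<inter> orth V (orth V F)"
  note K = isotropic_hull[OF assms(1,2)]
  obtain k where k: "k \<le> card V div 2" "card ?K = 2 ^ k"
    using card_isotropic_subspace[OF assms(1) K(1,2)] by blast
  have "F \<subseteq> orth V F" using assms(2,3) by (auto simp: orth_def isotropic_def)
  then have "card F \<le> card ?K"
    using K(3) subspace_in_finite[OF assms(1) K(1)] by (intro card_mono) auto
  also have "\<dots> \<le> 2 ^ (card V div 2)" unfolding k(2) using k(1) by (intro power_increasing) auto
  finally show ?thesis .
qed

section \<open>Counting odd pairs\<close>

definition odd_nbrs :: "'a set set \<Rightarrow> 'a set \<Rightarrow> 'a set set" where
  "odd_nbrs \<A> A = {B \<in> \<A>. odd (card (B \<inter> A))}"

lemma finite_odd_pairs: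
  assumes "finite \<A>" shows "finite (odd_pairs \<A>)"
proof -
  have "odd_pairs \<A> \<subseteq> Pow \<A>" by (auto simp: odd_pairs_def)
  then show ?thesis using assms finite_subset by blast
qed

lemma odd_pair_number_mono:
  assumes "finite \<B>" "\<A> \<subseteq> \<B>"
  shows "odd_pair_number \<A> \<le> odd_pair_number \<B>"
  unfolding odd_pair_number_def using assms
  by (intro card_mono finite_odd_pairs) (auto simp: odd_pairs_def)

text \<open>
  The handshake inequality: an unordered pair comes from at most two ordered ones. Even sizes ensure
  that no set counts as an odd neighbour of itself.
\<close>

lemma sum_card_odd_nbrs_le:
  assumes "finite \<A>" "even_sized \<A>"
  shows "(\<Sum>A\<in>\<A>. card (odd_nbrs \<A> A)) \<le> 2 * odd_pair_number \<A>"
proof -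
  let ?f = "\<lambda>e. {(A, B). {A, B} = (e :: 'a set set)}"
  have two: "finite (?f e) \<and> card (?f e) \<le> 2" if e: "e \<in> odd_pairs \<A>" for e
  proof -
    obtain A B where "e = {A, B}" using e by (auto simp: odd_pairs_def)
    then have sub: "?f e \<subseteq> {(A, B), (B, A)}" by (auto simp: doubleton_eq_iff)
    then have "card (?f e) \<le> card {(A, B), (B, A)}" by (intro card_mono) auto
    also have "\<dots> \<le> 2" by (rule order_trans[OF card_insert_le_m1]) auto
    finally show ?thesis using sub finite_subset by auto
  qed
  have "(\<Sum>A\<in>\<A>. card (odd_nbrs \<A> A)) = card (Sigma \<A> (odd_nbrs \<A>))"
    using assms by (intro card_SigmaI[symmetric]) (auto simp: odd_nbrs_def)
  also have "\<dots> \<le> card (\<Union>e\<in>odd_pairs \<A>. ?f e)"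
  proof (rule card_mono)
    show "finite (\<Union>e\<in>odd_pairs \<A>. ?f e)" using two finite_odd_pairs[OF assms(1)] by blast
    have "{A, B} \<in> odd_pairs \<A>" if "A \<in> \<A>" "B \<in> \<A>" "odd (card (B \<inter> A))" for A B
    proof -
      have "A \<noteq> B" using that assms(2) by (auto simp: even_sized_def)
      then show ?thesis using that unfolding odd_pairs_def by (auto simp: Int_commute)
    qed
    then show "Sigma \<A> (odd_nbrs \<A>) \<subseteq> (\<Union>e\<in>odd_pairs \<A>. ?f e)"
      by (auto simp: odd_nbrs_def)
  qed
  also have "\<dots> \<le> (\<Sum>e\<in>odd_pairs \<A>. card (?f e))"
    by (rule card_UN_le[OF finite_odd_pairs[OF assms(1)]])
  also have "\<dots> \<le> (\<Sum>e\<in>odd_pairs \<A>. 2)" by (rule sum_mono) (use two in blast)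
  finally show ?thesis by (simp add: odd_pair_number_def mult.commute)
qed

lemma few_of_large_degree:
  assumes "finite \<A>" "even_sized \<A>"
  shows "Suc t * card {A \<in> \<A>. t < card (odd_nbrs \<A> A)} \<le> 2 * odd_pair_number \<A>"
proof -
  let ?H = "{A \<in> \<A>. t < card (odd_nbrs \<A> A)}"
  have "Suc t * card ?H = (\<Sum>A\<in>?H. Suc t)" by simp
  also have "\<dots> \<le> (\<Sum>A\<in>?H. card (odd_nbrs \<A> A))" by (rule sum_mono) auto
  also have "\<dots> \<le> (\<Sum>A\<in>\<A>. card (odd_nbrs \<A> A))" using assms by (intro sum_mono2) auto
  finally show ?thesis using sum_card_odd_nbrs_le[OF assms] by linarith
qed

text \<open>
  Let \<open>B\<close> be the family of members of degree at most \<open>t\<close>. A member of \<open>\<A>\<close> outside the radical of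
  the span of \<open>B\<close> either has degree above \<open>t\<close> or is non-orthogonal to one of at most \<open>card V\<close>
  generators chosen from \<open>B\<close>, each of which has at most \<open>t\<close> odd neighbours.
\<close>

lemma mostly_isotropic:
  assumes "finite V" "\<A> \<subseteq> Pow V"
  obtains K where "subspace_in V K" "isotropic K"
    "card (\<A> - K) \<le> card {A \<in> \<A>. t < card (odd_nbrs \<A> A)} + card V * t"
proof -
  define B where "B = {A \<in> \<A>. card (odd_nbrs \<A> A) \<le> t}"
  let ?H = "{A \<in> \<A>. t < card (odd_nbrs \<A> A)}" and ?K = "orth V B \<inter> orth V (orth V B)"
  have BV: "B \<subseteq> Pow V" using assms by (auto simp: B_def)
  have fin: "finite \<A>" using assms finite_subset by auto
  obtain X where X: "X \<subseteq> B" "orth V X = orth V B" "card X \<le> card V"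
    using orth_generated_by_few[OF assms(1) BV] by blast
  have finX: "finite X" using X(1) fin by (auto simp: B_def intro: finite_subset)
  note K = isotropic_hull[OF assms(1) BV]
  have "\<A> - ?K \<subseteq> ?H \<union> (\<Union>x\<in>X. odd_nbrs \<A> x)"
  proof
    fix A assume A: "A \<in> \<A> - ?K"
    show "A \<in> ?H \<union> (\<Union>x\<in>X. odd_nbrs \<A> x)"
    proof (cases "A \<in> B")
      case True
      then have "A \<notin> orth V X" using A K(3) X(2) by auto
      then show ?thesis using A assms(2) by (auto simp: orth_def odd_nbrs_def Int_commute)
    next
      case False
      then show ?thesis using A by (auto simp: B_def)
    qed
  qed
  then have "card (\<A> - ?K) \<le> card (?H \<union> (\<Union>x\<in>X. odd_nbrs \<A> x))"
    using fin finX by (intro card_mono) (auto simp: odd_nbrs_def)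
  also have "\<dots> \<le> card ?H + card (\<Union>x\<in>X. odd_nbrs \<A> x)" by (rule card_Un_le)
  also have "card (\<Union>x\<in>X. odd_nbrs \<A> x) \<le> (\<Sum>x\<in>X. card (odd_nbrs \<A> x))"
    by (rule card_UN_le[OF finX])
  also have "\<dots> \<le> (\<Sum>x\<in>X. t)" by (rule sum_mono) (use X(1) in \<open>auto simp: B_def\<close>)
  also have "\<dots> \<le> card V * t" using X(3) by simp
  finally show ?thesis using K that by simp
qed

text \<open>
  An even set outside an isotropic subspace \<open>K\<close> of maximal cardinality cannot be orthogonal to all
  of \<open>K\<close>, since adding it would violate the eventown theorem. It is therefore non-orthogonal to exactly half
  of \<open>K\<close>, and at most \<open>card (K - \<A>)\<close> of these elements are missing from \<open>\<A>\<close>.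
\<close>

lemma odd_pairs_outside_maximal:
  assumes "finite V" "\<A> \<subseteq> Pow V" "even_sized \<A>"
    and K: "subspace_in V K" "isotropic K" "card K = 2 ^ (card V div 2)"
  shows "card (\<A> - K) * (card K div 2 - card (K - \<A>)) \<le> odd_pair_number \<A>"
proof -
  let ?g = "\<lambda>(A, B). {A, B :: 'a set}" and ?P = "Sigma (\<A> - K) (odd_nbrs (\<A> \<inter> K))"
  have fin: "finite \<A>" "finite K"
    using assms(1,2) subspace_in_finite[OF assms(1) K(1)] finite_subset by auto
  have deg: "card K div 2 - card (K - \<A>) \<le> card (odd_nbrs (\<A> \<inter> K) A)" if A: "A \<in> \<A> - K" for A
  proof -
    have "\<not> isotropic (insert A K)"
    proof
      assume "isotropic (insert A K)"
      moreover have "insert A K \<subseteq> Pow V" using A assms(2) K(1) by (auto simp: subspace_in_def)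
      ultimately have "card (insert A K) \<le> card K" using eventown_bound[OF assms(1)] K(3) by metis
      then show False using A fin by simp
    qed
    moreover have "even (card A)" using A assms(3) by (auto simp: even_sized_def)
    ultimately obtain w where w: "w \<in> K" "odd (card (w \<inter> A))"
      using K(2) by (auto simp: isotropic_def Int_commute)
    have "finite A" using A assms(1,2) by (meson DiffD1 PowD finite_subset subsetD)
    then have "card K div 2 = card (odd_nbrs K A)"
      using card_odd_Int_half(1)[OF assms(1) K(1) _ w] unfolding odd_nbrs_def by simp
    also have "\<dots> \<le> card (odd_nbrs (\<A> \<inter> K) A \<union> (K - \<A>))"
      using fin by (intro card_mono) (auto simp: odd_nbrs_def)
    also have "\<dots> \<le> card (odd_nbrs (\<A> \<inter> K) A) + card (K - \<A>)" by (rule card_Un_le)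
    finally show ?thesis by linarith
  qed
  have "card (\<A> - K) * (card K div 2 - card (K - \<A>)) = (\<Sum>A\<in>\<A> - K. card K div 2 - card (K - \<A>))"
    by simp
  also have "\<dots> \<le> (\<Sum>A\<in>\<A> - K. card (odd_nbrs (\<A> \<inter> K) A))" by (rule sum_mono) (rule deg)
  also have "\<dots> = card ?P"
    using fin by (intro card_SigmaI[symmetric]) (auto simp: odd_nbrs_def)
  also have "\<dots> = card (?g ` ?P)"
    by (rule card_image[symmetric]) (auto simp: inj_on_def odd_nbrs_def doubleton_eq_iff)
  also have "\<dots> \<le> odd_pair_number \<A>" unfolding odd_pair_number_def
  proof (intro card_mono finite_odd_pairs fin(1) subsetI)
    fix e assume "e \<in> ?g ` ?P"
    then obtain A B where "e = {A, B}" "A \<in> \<A>" "A \<notin> K" "B \<in> \<A>" "B \<in> K" "odd (card (A \<inter> B))"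
      by (auto simp: odd_nbrs_def Int_commute)
    then show "e \<in> odd_pairs \<A>" unfolding odd_pairs_def by blast
  qed
  finally show ?thesis .
qed

section \<open>Supersaturation\<close>

text \<open>
  The constant 24 gives \<open>3 s n \<le> N / 8\<close>, where \<open>n = card V\<close> and \<open>N = 2 ^ (n div 2)\<close>. Together with
  the fewer than \<open>N / 3\<close> members of degree above \<open>3 s\<close>, this leaves fewer than \<open>N / 2\<close> members
  outside the isotropic subspace.
\<close>

lemma eventown_supersaturation:
  fixes \<A> :: "'a set set"
  assumes V: "finite V" "card V \<ge> 2"
    and s: "s > 0" "24 * (s * card V) \<le> 2 ^ (card V div 2)"
    and A: "\<A> \<subseteq> Pow V" "even_sized \<A>" "2 ^ (card V div 2) + s \<le> card \<A>"
  shows "s * 2 ^ (card V div 2 - 1) \<le> odd_pair_number \<A>"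
proof (rule ccontr)
  \<comment> \<open>\<open>M\<close> is half of the eventown bound; \<open>card V \<ge> 2\<close> makes it an integer.\<close>
  define M :: nat where "M = 2 ^ (card V div 2 - 1)"
  have N: "2 ^ (card V div 2) = 2 * M"
    using V(2) unfolding M_def by (metis One_nat_def Suc_pred div_greater_zero_iff pos2 power_Suc)
  have finA: "finite \<A>" using A(1) V(1) finite_subset by auto
  \<comment> \<open>Passing to a subfamily of exactly \<open>2 M + s\<close> members does not increase the number of odd pairs.\<close>
  obtain \<B> where B: "\<B> \<subseteq> \<A>" "card \<B> = 2 * M + s" 
    using obtain_subset_with_card_n[of "2 * M + s" \<A>] A(3) N by auto
  have finB: "finite \<B>" using B(1) finA finite_subset by blast
  have BV: "\<B> \<subseteq> Pow V" "even_sized \<B>" using A B(1) by (auto simp: even_sized_def)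
  assume "\<not> ?thesis"
  then have few: "odd_pair_number \<B> < s * M"
    using odd_pair_number_mono[OF finA B(1)] by (simp add: M_def)
  obtain K where K: "subspace_in V K" "isotropic K"
    "card (\<B> - K) \<le> card {A \<in> \<B>. 3 * s < card (odd_nbrs \<B> A)} + card V * (3 * s)"
    using mostly_isotropic[OF V(1) BV(1)] by blast
  have finK: "finite K" using subspace_in_finite[OF V(1) K(1)] .
  let ?h = "card {A \<in> \<B>. 3 * s < card (odd_nbrs \<B> A)}"
  have "s * (3 * ?h) \<le> Suc (3 * s) * ?h" by simp
  also have "\<dots> < s * (2 * M)" using few_of_large_degree[OF finB BV(2), of "3 * s"] few by linarith
  finally have h: "3 * ?h < 2 * M" using s(1) by simp
  have out: "card (\<B> - K) < M"
    using h K(3) s(2) unfolding N by (simp add: ac_simps)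
  have split: "card \<B> = card (\<B> \<inter> K) + card (\<B> - K)" "card K = card (\<B> \<inter> K) + card (K - \<B>)"
    using card_Int_Diff[OF finB, of K] card_Int_Diff[OF finK, of \<B>] by (simp_all add: Int_commute)
  obtain k where k: "k \<le> card V div 2" "card K = 2 ^ k"
    using card_isotropic_subspace[OF V(1) K(1,2)] by blast
  have "k = card V div 2"
  proof (rule ccontr)
    assume "k \<noteq> card V div 2"
    then have "card K \<le> M" unfolding k(2) M_def using k(1) by (intro power_increasing) auto
    then show False using split B(2) out by linarith
  qed
  then have cK: "card K = 2 ^ (card V div 2)" using k(2) by simp
  define d where "d = card (K - \<B>)"
  have d: "card (\<B> - K) = d + s" using split B(2) cK N unfolding d_def by linarith
  \<comment> \<open>With \<open>M = d + s + r\<close>, the number \<open>(d + s) (M - d)\<close> exceeds \<open>s M\<close> by \<open>d r\<close>.\<close>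
  obtain r where r: "M = d + s + r" using out d by (metis less_imp_add_positive)
  have "s * M \<le> (d + s) * (s + r)" unfolding r by (simp add: algebra_simps)
  also have "\<dots> = card (\<B> - K) * (card K div 2 - card (K - \<B>))"
    unfolding d cK N d_def[symmetric] by (simp add: r)
  also have "\<dots> \<le> odd_pair_number \<B>"
    by (rule odd_pairs_outside_maximal[OF V(1) BV K(1,2) cK])
  finally show False using few by simp
qed

theorem theorem1p5:
  shows "\<exists>n0::nat. \<forall>n\<ge>n0. \<forall>s::nat. s > 0 \<longrightarrow> real s \<le> 2 ^ (n div 8) / real n \<longrightarrow>
    (\<forall>\<A> :: nat set set. \<A> \<subseteq> Pow {1..n} \<longrightarrow> even_sized \<A> \<longrightarrow>
       card \<A> \<ge> 2 ^ (n div 2) + s \<longrightarrow>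
       odd_pair_number \<A> \<ge> s * 2 ^ (n div 2 - 1))"
proof (intro exI[of _ 16] allI impI)
  fix n s :: nat and \<A> :: "nat set set"
  assume n: "16 \<le> n" and s: "s > 0" "real s \<le> 2 ^ (n div 8) / real n"
    and A: "\<A> \<subseteq> Pow {1..n}" "even_sized \<A>" "2 ^ (n div 2) + s \<le> card \<A>"
  \<comment> \<open>\<open>24 * (s * n) \<le> 2 ^ (n div 2)\<close> follows from \<open>24 \<le> 2 ^ 5\<close> once \<open>5 + n div 8 \<le> n div 2\<close>,
      which holds for \<open>n \<ge> 16\<close>.\<close>
  have "real (s * n) \<le> real (2 ^ (n div 8))" using s(2) n by (simp add: field_simps)
  then have "s * n \<le> 2 ^ (n div 8)" by (simp only: of_nat_le_iff)
  then have "24 * (s * n) \<le> 2 ^ 5 * 2 ^ (n div 8)" by (intro mult_mono) auto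
  also have "\<dots> = 2 ^ (5 + n div 8)" by (simp only: power_add)
  also have "\<dots> \<le> 2 ^ (n div 2)"
  proof (rule power_increasing)
    have "n div 8 = (n div 2) div 4" by (simp flip: div_mult2_eq)
    moreover have "8 \<le> n div 2" using n by simp
    ultimately show "5 + n div 8 \<le> n div 2" by simp
  qed simp
  finally show "s * 2 ^ (n div 2 - 1) \<le> odd_pair_number \<A>"
    using eventown_supersaturation[of "{1..n}" s \<A>] n s(1) A by simp
qed

end
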